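(* Let $\mathbb{T}$ be a time scale, let $A:\mathbb{T}\to\mathbb{R}^{n\times n}$ be regressive, and let $L$ be a Lyapunov transformation, with change of variables $z(t)=L^{-1}(t)x(t)$. Then the system $$x^\Delta(t)=A(t)x(t),\quad x(t_0)=x_0$$ is uniformly stable if and only if the system $$z^\Delta(t)=\left[(L^\sigma(t))^{-1}A(t)L(t)-(L^\sigma(t))^{-1}L^\Delta(t)\right]z(t),\quad z(t_0)=z_0$$ is uniformly stable.
   Context: A time scale $\mathbb{T}$ is a nonempty closed subset of $\mathbb{R}$; $\sigma(t)=\inf\{s\in\mathbb{T}:s>t\}$, $\mu(t)=\sigma(t)-t$, $L^\sigma(t)=L(\sigma(t))$, and $f^\Delta$ is the delta (Hilger) derivative. $f$ is rd-continuous if continuous at right-dense points with finite left-sided limits at left-dense points; $C^1_{\mathrm{rd}}$ is the set of delta differentiable functions with rd-continuous derivative. $A$ is regressive if it is rd-continuous and $I+\mu(t)A(t)$ is invertible for all $t$. A Lyapunov transformation is an invertible matrix $L(t)\in C^1_{\mathrm{rd}}(\mathbb{T},\mathbb{R}^{n\times n})$ such that, for some positive $\eta,\rho\in\mathbb{R}$, $\|L(t)\|\le\rho$ and $\det L(t)\ge\eta$ for all $t\in\mathbb{T}$. A linear system is uniformly stable if there is a finite constant $\gamma>0$ such that for any $t_0\in\mathbb{T}$ and any initial value $x(t_0)$ the corresponding solution satisfies $\|x(t)\|\le\gamma\|x(t_0)\|$ for all $t\in\mathbb{T}$, $t\ge t_0$. *)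

theory Defs
  imports "HOL-Analysis.Analysis"
begin

definition time_scale :: "real set \<Rightarrow> bool" where
  "time_scale T \<longleftrightarrow> T \<noteq> {} \<and> closed T"

text \<open>
  The jump operators follow the usual convention that the infimum of the empty set is
  \<open>sup T\<close> and the supremum of the empty set is \<open>inf T\<close>: a maximum is its own
  successor and a minimum its own predecessor.
\<close>

definition fwd_jump :: "real set \<Rightarrow> real \<Rightarrow> real" where
  "fwd_jump T t = (if {s\<in>T. s > t} = {} then t else Inf {s\<in>T. s > t})"

definition bwd_jump :: "real set \<Rightarrow> real \<Rightarrow> real" where
  "bwd_jump T t = (if {s\<in>T. s < t} = {} then t else Sup {s\<in>T. s < t})"

definition graininess :: "real set \<Rightarrow> real \<Rightarrow> real" where
  "graininess T t = fwd_jump T t - t"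

definition right_dense :: "real set \<Rightarrow> real \<Rightarrow> bool" where
  "right_dense T t \<longleftrightarrow> fwd_jump T t = t"

definition left_dense :: "real set \<Rightarrow> real \<Rightarrow> bool" where
  "left_dense T t \<longleftrightarrow> bwd_jump T t = t"

text \<open>
  The set \<open>T\<^sup>\<kappa>\<close> on which delta derivatives live: \<open>T\<close> without its maximum
  if that maximum is left-scattered. At such a point every value would satisfy the definition
  of the delta derivative.
\<close>

definition kappa :: "real set \<Rightarrow> real set" where
  "kappa T = T - {t. (\<forall>s\<in>T. s \<le> t) \<and> bwd_jump T t < t}"

definition has_delta_derivative ::
    "real set \<Rightarrow> (real \<Rightarrow> 'a::real_normed_vector) \<Rightarrow> 'a \<Rightarrow> real \<Rightarrow> bool" where
  "has_delta_derivative T f D t \<longleftrightarrow>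
     (\<forall>\<epsilon>>0. \<exists>\<delta>>0. \<forall>s\<in>T. \<bar>s - t\<bar> < \<delta> \<longrightarrow>
        norm (f (fwd_jump T t) - f s - (fwd_jump T t - s) *\<^sub>R D)
          \<le> \<epsilon> * \<bar>fwd_jump T t - s\<bar>)"

definition delta_differentiable ::
    "real set \<Rightarrow> (real \<Rightarrow> 'a::real_normed_vector) \<Rightarrow> real \<Rightarrow> bool" where
  "delta_differentiable T f t \<longleftrightarrow> (\<exists>D. has_delta_derivative T f D t)"

definition delta_deriv ::
    "real set \<Rightarrow> (real \<Rightarrow> 'a::real_normed_vector) \<Rightarrow> real \<Rightarrow> 'a" where
  "delta_deriv T f t = (SOME D. has_delta_derivative T f D t)"

text \<open>
  Rd-continuity of a function with domain \<open>S\<close>, where \<open>S\<close> is \<open>T\<close> or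
  \<open>T\<^sup>\<kappa>\<close> (the domain of a delta derivative). Points are classified as dense or
  scattered in \<open>T\<close>.
\<close>

definition rd_continuous_on ::
    "real set \<Rightarrow> real set \<Rightarrow> (real \<Rightarrow> 'a::topological_space) \<Rightarrow> bool" where
  "rd_continuous_on T S f \<longleftrightarrow>
     (\<forall>t\<in>S. (right_dense T t \<longrightarrow> continuous (at t within S) f) \<and>
            (left_dense T t \<longrightarrow> (\<exists>l. (f \<longlongrightarrow> l) (at t within (S \<inter> {..<t})))))"

definition C1_rd :: "real set \<Rightarrow> (real \<Rightarrow> 'a::real_normed_vector) \<Rightarrow> bool" where
  "C1_rd T f \<longleftrightarrow>
     (\<forall>t\<in>kappa T. delta_differentiable T f t) \<and> rd_continuous_on T (kappa T) (delta_deriv T f)"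

definition regressive :: "real set \<Rightarrow> (real \<Rightarrow> real^'n^'n) \<Rightarrow> bool" where
  "regressive T A \<longleftrightarrow>
     rd_continuous_on T T A \<and> (\<forall>t\<in>T. invertible (mat 1 + graininess T t *\<^sub>R A t))"

text \<open>
  The norm of a matrix is the operator norm induced by the Euclidean norm; \<open>norm\<close> on the
  matrix type would be the Frobenius norm.
\<close>

definition lyapunov_transformation :: "real set \<Rightarrow> (real \<Rightarrow> real^'n^'n) \<Rightarrow> bool" where
  "lyapunov_transformation T L \<longleftrightarrow>
     (\<forall>t\<in>T. invertible (L t)) \<and> C1_rd T L \<and>
     (\<exists>\<eta> \<rho>. \<eta> > 0 \<and> \<rho> > 0 \<and>
        (\<forall>t\<in>T. onorm ((*v) (L t)) \<le> \<rho> \<and> det (L t) \<ge> \<eta>))"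

definition solves_linear_ivp ::
    "real set \<Rightarrow> (real \<Rightarrow> real^'n^'n) \<Rightarrow> real \<Rightarrow> real^'n \<Rightarrow> (real \<Rightarrow> real^'n) \<Rightarrow> bool" where
  "solves_linear_ivp T A t0 x0 x \<longleftrightarrow>
     x t0 = x0 \<and> (\<forall>t\<in>kappa T. has_delta_derivative T x (A t *v x t) t)"

definition uniformly_stable :: "real set \<Rightarrow> (real \<Rightarrow> real^'n^'n) \<Rightarrow> bool" where
  "uniformly_stable T A \<longleftrightarrow>
     (\<exists>\<gamma>>0. \<forall>t0\<in>T. \<forall>x0 x. solves_linear_ivp T A t0 x0 x \<longrightarrow>
        (\<forall>t\<in>T. t \<ge> t0 \<longrightarrow> norm (x t) \<le> \<gamma> * norm x0))"

end

theory Submission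
  imports Defs
begin

text \<open>
  The change of variables is a bijection between the solutions of the two systems: both
  directions are the product rule \<open>(F g)\<^sup>\<Delta> = F\<^sup>\<sigma> g\<^sup>\<Delta> + F\<^sup>\<Delta> g\<close>,
  applied to \<open>x = L z\<close> and to \<open>z = L\<^sup>-\<^sup>1 x\<close>. By Cramer's rule the bounds on \<open>\<parallel>L\<parallel>\<close>
  and \<open>det L\<close> give a uniform bound on \<open>\<parallel>L\<^sup>-\<^sup>1\<parallel>\<close>, so stability estimates carry
  over with a constant factor. The differentiation rules are derived from a
  Caratheodory-style characterisation of the delta derivative, which reduces them to continuity.
\<close>

section \<open>Continuity and inverses of matrices\<close>

lemma continuous_vec_componentwise:
  fixes f :: "'a::t2_space \<Rightarrow> 'b::topological_space^'n"
  shows "(\<And>i. continuous F (\<lambda>x. f x $ i)) \<Longrightarrow> continuous F f"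
  unfolding continuous_def by (rule vec_tendstoI)

lemma continuous_vec_nth:
  "continuous F f \<Longrightarrow> continuous F (\<lambda>x. f x $ i)"
  unfolding continuous_def by (rule tendsto_vec_nth)

lemma continuous_matrix_vector_mult:
  fixes A :: "'a::t2_space \<Rightarrow> real^'n^'m"
  assumes "continuous F A" and "continuous F x"
  shows "continuous F (\<lambda>s. A s *v x s)"
  by (rule continuous_vec_componentwise)
    (auto simp: matrix_vector_mult_def intro!: continuous_intros continuous_vec_nth assms)

lemma continuous_matrix_mult:
  fixes A :: "'a::t2_space \<Rightarrow> real^'n^'m" and B :: "'a \<Rightarrow> real^'k^'n"
  assumes "continuous F A" and "continuous F B"
  shows "continuous F (\<lambda>s. A s ** B s)"
  by (rule continuous_vec_componentwise, rule continuous_vec_componentwise)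
    (auto simp: matrix_matrix_mult_def intro!: continuous_intros continuous_vec_nth assms)

text \<open>Continuity is assumed entry by entry because the Cramer matrix, with one column
  replaced, is accessible only through its entries.\<close>

lemma continuous_det:
  fixes A :: "'a::t2_space \<Rightarrow> real^'n^'n"
  assumes "\<And>i j. continuous F (\<lambda>s. A s $ i $ j)"
  shows "continuous F (\<lambda>s. det (A s))"
  unfolding det_def by (intro continuous_intros assms)

text \<open>The Leibniz expansion has n! terms, each up to sign a product of n entries.\<close>

lemma abs_det_le:
  fixes A :: "real^'n^'n"
  assumes "\<And>i j. \<bar>A $ i $ j\<bar> \<le> c"
  shows "\<bar>det A\<bar> \<le> fact CARD('n) * c ^ CARD('n)"
proof -
  let ?P = "{p. p permutes (UNIV :: 'n set)}"
  have "\<bar>det A\<bar> \<le> (\<Sum>p\<in>?P. \<bar>of_int (sign p) * (\<Prod>i\<in>UNIV. A $ i $ p i)\<bar>)"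
    unfolding det_def by (rule sum_abs)
  also have "\<dots> \<le> (\<Sum>p\<in>?P. c ^ CARD('n))"
  proof (rule sum_mono)
    fix p :: "'n \<Rightarrow> 'n"
    have "\<bar>of_int (sign p) * (\<Prod>i\<in>UNIV. A $ i $ p i)\<bar> = (\<Prod>i\<in>UNIV. \<bar>A $ i $ p i\<bar>)"
      by (simp add: abs_mult abs_prod sign_def)
    also have "\<dots> \<le> (\<Prod>i\<in>(UNIV::'n set). c)"
      by (rule prod_mono) (auto simp: assms)
    finally show "\<bar>of_int (sign p) * (\<Prod>i\<in>UNIV. A $ i $ p i)\<bar> \<le> c ^ CARD('n)"
      by simp
  qed
  also have "\<dots> = fact CARD('n) * c ^ CARD('n)"
    by (simp add: card_permutations[OF refl])
  finally show ?thesis .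
qed

lemma
  fixes A :: "'a::field^'n^'n"
  assumes "invertible A"
  shows matrix_mul_matrix_inv: "A ** matrix_inv A = mat 1"
    and matrix_inv_matrix_mul: "matrix_inv A ** A = mat 1"
  using someI_ex[OF assms[unfolded invertible_def]] by (auto simp: matrix_inv_def)

text \<open>Column \<open>l\<close> of the inverse solves A x = e_l, so Cramer's rule gives its
  \<open>k\<close>-th entry. This quotient of determinants serves both the uniform bound on the
  inverse and its continuity.\<close>

lemma matrix_inv_component:
  fixes A :: "'a::field^'n^'n"
  assumes "invertible A"
  shows "matrix_inv A $ k $ l =
    det (\<chi> i j. if j = k then axis l 1 $ i else A $ i $ j) / det A"
proof -
  have "A *v (matrix_inv A *v axis l 1) = axis l 1"
    by (simp add: matrix_vector_mul_assoc matrix_mul_matrix_inv assms)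
  moreover have "(matrix_inv A *v axis l 1) $ k = matrix_inv A $ k $ l"
    by (simp add: matrix_vector_mul_component axis_def matrix_vector_mult_def if_distrib cong: if_cong)
  moreover have "det A \<noteq> 0"
    using assms by (simp add: invertible_det_nz)
  ultimately show ?thesis
    using cramer_lemma[where A = A and x = "matrix_inv A *v axis l 1" and k = k]
    by (simp add: field_simps cong: if_cong)
qed

text \<open>Entries of \<open>A\<close> are at most \<open>\<rho>\<close> in absolute value, and the
  column replaced in Cramer's rule contains only 0 and 1; hence \<open>max 1 \<rho>\<close>. The
  numerator is bounded by \<open>abs_det_le\<close>, the denominator from below by
  \<open>\<eta>\<close>, and the factor n * n passes from entries to the operator norm.\<close>

lemma onorm_matrix_inv_le:
  fixes A :: "real^'n^'n"
  assumes "0 < \<eta>" and det: "\<eta> \<le> det A" and on: "onorm ((*v) A) \<le> \<rho>"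
  shows "onorm ((*v) (matrix_inv A)) \<le>
    real CARD('n) * real CARD('n) * (fact CARD('n) * max 1 \<rho> ^ CARD('n) / \<eta>)"
proof (rule onorm_le_matrix_component)
  fix k l
  let ?D = "det (\<chi> i j. if j = k then axis l 1 $ i else A $ i $ j)"
  have A: "\<bar>A $ i $ j\<bar> \<le> max 1 \<rho>" for i j
    using matrix_component_le_onorm[of A i j] on by linarith
  have "\<bar>?D\<bar> \<le> fact CARD('n) * max 1 \<rho> ^ CARD('n)"
    by (rule abs_det_le) (auto simp: A axis_def)
  then have "\<bar>?D\<bar> / det A \<le> fact CARD('n) * max 1 \<rho> ^ CARD('n) / \<eta>"
    using assms by (intro frac_le) auto
  moreover have "invertible A"
    using assms by (simp add: invertible_det_nz)
  ultimately show "\<bar>matrix_inv A $ k $ l\<bar> \<le> fact CARD('n) * max 1 \<rho> ^ CARD('n) / \<eta>"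
    using assms by (simp add: matrix_inv_component)
qed

lemma continuous_matrix_inv:
  fixes A :: "'a::metric_space \<Rightarrow> real^'n^'n"
  assumes cont: "continuous (at t within S) A" and "t \<in> S" and inv: "\<And>s. s \<in> S \<Longrightarrow> invertible (A s)"
  shows "continuous (at t within S) (\<lambda>s. matrix_inv (A s))"
proof (rule continuous_vec_componentwise, rule continuous_vec_componentwise)
  fix k l
  let ?q = "\<lambda>s. det (\<chi> i j. if j = k then axis l 1 $ i else A s $ i $ j) / det (A s)"
  have entry: "continuous (at t within S) (\<lambda>s. A s $ i $ j)" for i j
    by (intro continuous_vec_nth cont)
  have "continuous (at t within S) ?q"
  proof (rule continuous_at_within_divide)
    show "continuous (at t within S) (\<lambda>s. det (\<chi> i j. if j = k then axis l 1 $ i else A s $ i $ j))"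
    proof (rule continuous_det)
      show "continuous (at t within S)
          (\<lambda>s. (\<chi> i j. if j = k then axis l 1 $ i else A s $ i $ j) $ i $ j)" for i j
        by (cases "j = k") (simp_all add: entry)
    qed
    show "continuous (at t within S) (\<lambda>s. det (A s))"
      by (rule continuous_det) (rule entry)
    show "det (A t) \<noteq> 0"
      using inv[OF \<open>t \<in> S\<close>] by (simp add: invertible_det_nz)
  qed
  then show "continuous (at t within S) (\<lambda>s. matrix_inv (A s) $ k $ l)"
    by (rule continuous_transform_within[OF _ zero_less_one \<open>t \<in> S\<close>])
      (simp add: matrix_inv_component inv)
qed

section \<open>Delta derivatives\<close>

text \<open>Closedness keeps the infimum inside \<open>T\<close>. This makes L invertible at the
  forward jump, where both the transformed system and the derivative of the inverse evaluate
  it.\<close>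

lemma fwd_jump_in:
  assumes "closed T" and "t \<in> T"
  shows "fwd_jump T t \<in> T"
proof (cases "{s\<in>T. s > t} = {}")
  case False
  have "bdd_below {s\<in>T. s > t}"
    by (rule bdd_belowI[of _ t]) auto
  with False have "Inf {s\<in>T. s > t} \<in> closure {s\<in>T. s > t}"
    by (rule closure_contains_Inf)
  also have "\<dots> \<subseteq> T"
    using assms by (intro closure_minimal) auto
  finally show ?thesis
    unfolding fwd_jump_def by (simp only: False if_False)
qed (simp add: fwd_jump_def assms)

text \<open>Here \<open>\<phi> s\<close> is the slope between \<open>s\<close> and the forward jump
  of \<open>t\<close>. The increment becomes an exact identity on \<open>T\<close> and the limit
  becomes continuity of \<open>\<phi>\<close> at \<open>t\<close>, so later rules need no split into
  right-dense and right-scattered points.\<close>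

lemma has_delta_derivative_iff_caratheodory:
  assumes "t \<in> T"
  shows "has_delta_derivative T f D t \<longleftrightarrow>
    (\<exists>\<phi>. continuous (at t within T) \<phi> \<and> \<phi> t = D \<and>
      (\<forall>s\<in>T. f (fwd_jump T t) - f s = (fwd_jump T t - s) *\<^sub>R \<phi> s))"
    (is "_ \<longleftrightarrow> (\<exists>\<phi>. ?C \<phi>)")
proof
  let ?u = "fwd_jump T t"
  assume der: "has_delta_derivative T f D t"
  \<comment> \<open>At s = \<open>?u\<close> the quotient is 0/0; any value satisfies the increment
    identity there, and \<open>D\<close> is the one that gives continuity when \<open>t\<close> is
    right-dense.\<close>
  define \<phi> where "\<phi> s = (if s = ?u then D else (f ?u - f s) /\<^sub>R (?u - s))" for s
  have quot: "f ?u - f s = (?u - s) *\<^sub>R \<phi> s" for s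
    by (simp add: \<phi>_def)
  have near: "\<exists>\<delta>>0. \<forall>s\<in>T. \<bar>s - t\<bar> < \<delta> \<longrightarrow> norm (\<phi> s - D) \<le> \<epsilon>" if pos: "\<epsilon> > 0" for \<epsilon>
  proof -
    obtain \<delta> where "\<delta> > 0" and \<delta>: "\<And>s. s \<in> T \<Longrightarrow> \<bar>s - t\<bar> < \<delta> \<Longrightarrow>
        norm (f ?u - f s - (?u - s) *\<^sub>R D) \<le> \<epsilon> * \<bar>?u - s\<bar>"
      using der[unfolded has_delta_derivative_def, rule_format, OF pos] by auto
    have "norm (\<phi> s - D) \<le> \<epsilon>" if s: "s \<in> T" "\<bar>s - t\<bar> < \<delta>" for s
    proof (cases "s = ?u")
      case True
      then show ?thesis using \<open>\<epsilon> > 0\<close> by (simp add: \<phi>_def)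
    next
      case False
      have "f ?u - f s - (?u - s) *\<^sub>R D = (?u - s) *\<^sub>R (\<phi> s - D)"
        by (simp add: quot scaleR_diff_right)
      then have "\<bar>?u - s\<bar> * norm (\<phi> s - D) \<le> \<bar>?u - s\<bar> * \<epsilon>"
        using \<delta>[OF s] by (simp add: mult.commute)
      then show ?thesis using False by simp
    qed
    with \<open>\<delta> > 0\<close> show ?thesis by blast
  qed
  \<comment> \<open>At a right-scattered \<open>t\<close>, \<open>\<phi> t\<close> is a genuine
    quotient; it equals \<open>D\<close> because s = t lies within every
    \<open>\<delta>\<close>.\<close>
  have "norm (\<phi> t - D) \<le> 0"
  proof (rule field_le_epsilon)
    fix \<epsilon> :: real assume "\<epsilon> > 0"
    then obtain \<delta> where "\<delta> > 0" and "\<forall>s\<in>T. \<bar>s - t\<bar> < \<delta> \<longrightarrow> norm (\<phi> s - D) \<le> \<epsilon>"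
      using near by blast
    with assms show "norm (\<phi> t - D) \<le> 0 + \<epsilon>"
      by simp
  qed
  then have "\<phi> t = D" by simp
  moreover have "continuous (at t within T) \<phi>"
    unfolding continuous_within_eps_delta dist_norm \<open>\<phi> t = D\<close> real_norm_def
  proof (intro allI impI)
    fix \<epsilon> :: real assume "\<epsilon> > 0"
    \<comment> \<open>Halving \<open>\<epsilon>\<close> turns the non-strict bound of
      \<open>near\<close> into the strict one of continuity.\<close>
    then obtain \<delta> where "\<delta> > 0" and \<delta>: "\<forall>s\<in>T. \<bar>s - t\<bar> < \<delta> \<longrightarrow> norm (\<phi> s - D) \<le> \<epsilon> / 2"
      using near[of "\<epsilon> / 2"] by auto
    have "norm (\<phi> s - D) < \<epsilon>" if "s \<in> T" "\<bar>s - t\<bar> < \<delta>" for s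
    proof -
      have "norm (\<phi> s - D) \<le> \<epsilon> / 2" using \<delta> that by blast
      then show ?thesis using \<open>\<epsilon> > 0\<close> by linarith
    qed
    with \<open>\<delta> > 0\<close> show "\<exists>\<delta>>0. \<forall>s\<in>T. \<bar>s - t\<bar> < \<delta> \<longrightarrow> norm (\<phi> s - D) < \<epsilon>"
      by blast
  qed
  ultimately show "\<exists>\<phi>. ?C \<phi>" using quot by blast
next
  let ?u = "fwd_jump T t"
  assume "\<exists>\<phi>. ?C \<phi>"
  then obtain \<phi> where cont: "continuous (at t within T) \<phi>" and "\<phi> t = D"
    and quot: "\<And>s. s \<in> T \<Longrightarrow> f ?u - f s = (?u - s) *\<^sub>R \<phi> s"
    by blast
  show "has_delta_derivative T f D t"
    unfolding has_delta_derivative_def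
  proof (intro allI impI)
    fix \<epsilon> :: real assume pos: "\<epsilon> > 0"
    obtain \<delta> where "\<delta> > 0" and \<delta>: "\<And>s. s \<in> T \<Longrightarrow> \<bar>s - t\<bar> < \<delta> \<Longrightarrow> norm (\<phi> s - D) < \<epsilon>"
      using cont[unfolded continuous_within_eps_delta dist_norm \<open>\<phi> t = D\<close> real_norm_def, rule_format, OF pos]
      by auto
    have "norm (f ?u - f s - (?u - s) *\<^sub>R D) \<le> \<epsilon> * \<bar>?u - s\<bar>" if "s \<in> T" "\<bar>s - t\<bar> < \<delta>" for s
    proof -
      have "norm (f ?u - f s - (?u - s) *\<^sub>R D) = \<bar>?u - s\<bar> * norm (\<phi> s - D)"
        by (simp add: quot that flip: scaleR_diff_right)
      also have "\<dots> \<le> \<bar>?u - s\<bar> * \<epsilon>"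
        using \<delta>[OF that] by (intro mult_left_mono) auto
      finally show ?thesis by (simp add: mult.commute)
    qed
    with \<open>\<delta> > 0\<close> show "\<exists>\<delta>>0. \<forall>s\<in>T. \<bar>s - t\<bar> < \<delta> \<longrightarrow>
        norm (f ?u - f s - (?u - s) *\<^sub>R D) \<le> \<epsilon> * \<bar>?u - s\<bar>"
      by blast
  qed
qed

text \<open>On \<open>T\<close>, f s = f u - (u - s) \<phi> s with u the forward jump of
  \<open>t\<close>, and the right side is continuous at \<open>t\<close>.\<close>

lemma has_delta_derivative_imp_continuous:
  assumes "has_delta_derivative T f D t" and "t \<in> T"
  shows "continuous (at t within T) f"
proof -
  let ?u = "fwd_jump T t"
  obtain \<phi> where cont: "continuous (at t within T) \<phi>"
    and quot: "\<And>s. s \<in> T \<Longrightarrow> f ?u - f s = (?u - s) *\<^sub>R \<phi> s"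
    using assms(1) unfolding has_delta_derivative_iff_caratheodory[OF assms(2)] by auto
  have "continuous (at t within T) (\<lambda>s. f ?u - (?u - s) *\<^sub>R \<phi> s)"
    by (intro continuous_intros cont)
  then show ?thesis
    by (rule continuous_transform_within[OF _ zero_less_one \<open>t \<in> T\<close>])
      (simp flip: quot)
qed

lemma has_delta_derivative_matrix_vector_mult:
  fixes F :: "real \<Rightarrow> real^'n^'m"
  assumes F: "has_delta_derivative T F DF t" and g: "has_delta_derivative T g Dg t" and "t \<in> T"
  shows "has_delta_derivative T (\<lambda>s. F s *v g s) (F (fwd_jump T t) *v Dg + DF *v g t) t"
proof -
  let ?u = "fwd_jump T t"
  obtain \<phi> where \<phi>: "continuous (at t within T) \<phi>" "\<phi> t = DF"
    "\<And>s. s \<in> T \<Longrightarrow> F ?u - F s = (?u - s) *\<^sub>R \<phi> s"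
    using F unfolding has_delta_derivative_iff_caratheodory[OF \<open>t \<in> T\<close>] by auto
  obtain \<psi> where \<psi>: "continuous (at t within T) \<psi>" "\<psi> t = Dg"
    "\<And>s. s \<in> T \<Longrightarrow> g ?u - g s = (?u - s) *\<^sub>R \<psi> s"
    using g unfolding has_delta_derivative_iff_caratheodory[OF \<open>t \<in> T\<close>] by auto
  let ?\<chi> = "\<lambda>s. F ?u *v \<psi> s + \<phi> s *v g s"
  have "F ?u *v g ?u - F s *v g s = (?u - s) *\<^sub>R ?\<chi> s" if "s \<in> T" for s
  proof -
    \<comment> \<open>Inserting F u g s, rather than F s g u, puts the jump on F; the other factor g
      s is continuous at \<open>t\<close>, so \<open>?\<chi>\<close> is an admissible slope
      function.\<close>
    have "F ?u *v g ?u - F s *v g s = F ?u *v (g ?u - g s) + (F ?u - F s) *v g s"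
      by (simp add: algebra_simps)
    also have "\<dots> = (?u - s) *\<^sub>R ?\<chi> s"
      by (simp add: \<phi>(3) \<psi>(3) that matrix_vector_mult_scaleR scaleR_add_right
          flip: scaleR_matrix_vector_assoc)
    finally show ?thesis .
  qed
  moreover have "continuous (at t within T) ?\<chi>"
    by (intro continuous_add continuous_matrix_vector_mult continuous_const \<phi> \<psi>
        has_delta_derivative_imp_continuous[OF g \<open>t \<in> T\<close>])
  ultimately show ?thesis
    unfolding has_delta_derivative_iff_caratheodory[OF \<open>t \<in> T\<close>]
    using \<phi>(2) \<psi>(2) by (intro exI[of _ ?\<chi>]) simp
qed

text \<open>The resolvent-type identity: it expresses an increment of the inverse through an
  increment of the matrix, with the order of the factors kept.\<close>

lemma matrix_inv_diff:
  fixes A B :: "real^'n^'n"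
  assumes "invertible A" and "invertible B"
  shows "matrix_inv A - matrix_inv B = - (matrix_inv A ** (A - B) ** matrix_inv B)"
proof -
  have "matrix_inv A ** (A - B) ** matrix_inv B
    = matrix_inv A ** A ** matrix_inv B - matrix_inv A ** (B ** matrix_inv B)"
    by (simp add: matrix_eq matrix_vector_mul_assoc[symmetric] matrix_vector_mult_diff_rdistrib
        matrix_vector_mult_diff_distrib)
  then show ?thesis
    by (simp add: assms matrix_mul_matrix_inv matrix_inv_matrix_mul)
qed

lemma has_delta_derivative_matrix_inv:
  fixes L :: "real \<Rightarrow> real^'n^'n"
  assumes L: "has_delta_derivative T L D t" and "t \<in> T" and "closed T"
    and inv: "\<And>s. s \<in> T \<Longrightarrow> invertible (L s)"
  shows "has_delta_derivative T (\<lambda>s. matrix_inv (L s))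
    (- (matrix_inv (L (fwd_jump T t)) ** D ** matrix_inv (L t))) t"
proof -
  let ?u = "fwd_jump T t"
  obtain \<phi> where \<phi>: "continuous (at t within T) \<phi>" "\<phi> t = D"
    "\<And>s. s \<in> T \<Longrightarrow> L ?u - L s = (?u - s) *\<^sub>R \<phi> s"
    using L unfolding has_delta_derivative_iff_caratheodory[OF \<open>t \<in> T\<close>] by auto
  \<comment> \<open>The slope function of the inverse, read off from \<open>matrix_inv_diff\<close>
    with L u and L s.\<close>
  let ?\<chi> = "\<lambda>s. - (matrix_inv (L ?u) ** \<phi> s ** matrix_inv (L s))"
  have "matrix_inv (L ?u) - matrix_inv (L s) = (?u - s) *\<^sub>R ?\<chi> s" if "s \<in> T" for s
    by (simp add: matrix_inv_diff inv fwd_jump_in assms(2,3) that \<phi>(3)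
        scalar_matrix_assoc matrix_scalar_ac)
  moreover have "continuous (at t within T) ?\<chi>"
    by (intro continuous_minus continuous_matrix_mult continuous_const \<phi> continuous_matrix_inv
        has_delta_derivative_imp_continuous[OF L] inv \<open>t \<in> T\<close>)
  ultimately show ?thesis
    unfolding has_delta_derivative_iff_caratheodory[OF \<open>t \<in> T\<close>]
    using \<phi>(2) by (intro exI[of _ ?\<chi>]) simp
qed

section \<open>Uniform stability under a change of variables\<close>

text \<open>Used once per direction. \<open>P\<close> carries solutions of the
  \<open>B\<close>-system to solutions of the stable \<open>A\<close>-system and \<open>Q\<close>
  recovers them, so the stability constant becomes \<open>q * \<gamma> * p\<close>.\<close>

lemma uniformly_stable_transfer:
  fixes A B :: "real \<Rightarrow> real^'n^'n" and P Q :: "real \<Rightarrow> real^'n^'n"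
  assumes stable: "uniformly_stable T A"
    and solves: "\<And>t0 x0 x. t0 \<in> T \<Longrightarrow> solves_linear_ivp T B t0 x0 x \<Longrightarrow>
      solves_linear_ivp T A t0 (P t0 *v x0) (\<lambda>t. P t *v x t)"
    and QP: "\<And>t. t \<in> T \<Longrightarrow> Q t ** P t = mat 1"
    and P: "\<And>t. t \<in> T \<Longrightarrow> onorm ((*v) (P t)) \<le> p" and "0 < p"
    and Q: "\<And>t. t \<in> T \<Longrightarrow> onorm ((*v) (Q t)) \<le> q" and "0 < q"
  shows "uniformly_stable T B"
proof -
  obtain \<gamma> where "\<gamma> > 0" and \<gamma>: "\<And>t0 x0 x t. t0 \<in> T \<Longrightarrow> solves_linear_ivp T A t0 x0 x \<Longrightarrow>
      t \<in> T \<Longrightarrow> t0 \<le> t \<Longrightarrow> norm (x t) \<le> \<gamma> * norm x0"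
    using stable unfolding uniformly_stable_def by blast
  have bound: "norm (M *v y) \<le> c * norm y" if "onorm ((*v) M) \<le> c" for M :: "real^'n^'n" and y c
    using onorm[OF matrix_vector_mul_bounded_linear, of M y] mult_right_mono[OF that norm_ge_zero[of y]]
    by linarith
  have "norm (x t) \<le> q * \<gamma> * p * norm x0"
    if "t0 \<in> T" "solves_linear_ivp T B t0 x0 x" "t \<in> T" "t0 \<le> t" for t0 x0 x t
  proof -
    have "norm (x t) = norm (Q t *v (P t *v x t))"
      by (simp add: matrix_vector_mul_assoc QP that)
    also have "\<dots> \<le> q * norm (P t *v x t)"
      by (intro bound Q that)
    also have "\<dots> \<le> q * (\<gamma> * norm (P t0 *v x0))"
      using \<gamma>[OF that(1) solves[OF that(1,2)] that(3,4)] \<open>0 < q\<close> by simp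
    also have "\<dots> \<le> q * (\<gamma> * (p * norm x0))"
      using \<open>0 < q\<close> \<open>\<gamma> > 0\<close> bound[OF P[OF that(1)]] by simp
    finally show ?thesis by (simp add: mult.assoc)
  qed
  moreover have "q * \<gamma> * p > 0"
    using \<open>0 < q\<close> \<open>0 < p\<close> \<open>\<gamma> > 0\<close> by simp
  ultimately show ?thesis
    unfolding uniformly_stable_def by blast
qed

theorem theorem2p11:
  fixes T :: "real set" and A L :: "real \<Rightarrow> real^'n^'n"
  assumes "time_scale T"
    and "regressive T A"
    and "lyapunov_transformation T L"
  shows "uniformly_stable T A \<longleftrightarrow>
    uniformly_stable T (\<lambda>t.
      matrix_inv (L (fwd_jump T t)) ** A t ** L t
      - matrix_inv (L (fwd_jump T t)) ** delta_deriv T L t)"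
    (is "_ \<longleftrightarrow> uniformly_stable T ?B")
proof -
  let ?M = "\<lambda>t. matrix_inv (L t)"
  have "closed T"
    using assms(1) by (simp add: time_scale_def)
  obtain \<eta> \<rho> where inv: "\<And>t. t \<in> T \<Longrightarrow> invertible (L t)" and "C1_rd T L"
    and "\<eta> > 0" "\<rho> > 0" and L: "\<And>t. t \<in> T \<Longrightarrow> onorm ((*v) (L t)) \<le> \<rho>"
    and det: "\<And>t. t \<in> T \<Longrightarrow> \<eta> \<le> det (L t)"
    using assms(3) unfolding lyapunov_transformation_def by blast
  have kappa: "t \<in> T" if "t \<in> kappa T" for t
    using that by (simp add: kappa_def)
  \<comment> \<open>\<open>delta_deriv\<close> is a choice, meaningful only where a derivative
    exists, which \<open>C1_rd\<close> guarantees on \<open>kappa T\<close>.\<close>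
  have L': "has_delta_derivative T L (delta_deriv T L t) t" if "t \<in> kappa T" for t
    using \<open>C1_rd T L\<close> that unfolding C1_rd_def delta_differentiable_def delta_deriv_def
    by (metis someI_ex)
  note jump = inv[OF fwd_jump_in[OF \<open>closed T\<close> kappa]]
  define q where "q = real CARD('n) * real CARD('n) * (fact CARD('n) * max 1 \<rho> ^ CARD('n) / \<eta>)"
  have "q > 0"
    using \<open>\<eta> > 0\<close> by (simp add: q_def less_max_iff_disj)
  have M: "onorm ((*v) (?M t)) \<le> q" if "t \<in> T" for t
    unfolding q_def using \<open>\<eta> > 0\<close> det[OF that] L[OF that] by (rule onorm_matrix_inv_le)
  have from_z: "solves_linear_ivp T A t0 (L t0 *v z0) (\<lambda>t. L t *v z t)"
    if "solves_linear_ivp T ?B t0 z0 z" for t0 z0 z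
    unfolding solves_linear_ivp_def
  proof (intro conjI ballI)
    fix t assume t: "t \<in> kappa T"
    \<comment> \<open>Multiplication by L at the jump cancels the inverse in \<open>?B\<close>; its
      second term then cancels the \<open>delta_deriv\<close> term of the product rule.\<close>
    have "L (fwd_jump T t) *v (?B t *v z t) + delta_deriv T L t *v z t = A t *v (L t *v z t)"
      using matrix_mul_matrix_inv[OF jump[OF t]]
      by (simp add: matrix_vector_mult_diff_rdistrib matrix_vector_mult_diff_distrib
          matrix_vector_mul_assoc matrix_mul_assoc)
    then show "has_delta_derivative T (\<lambda>t. L t *v z t) (A t *v (L t *v z t)) t"
      using has_delta_derivative_matrix_vector_mult[OF L'[OF t] _ kappa[OF t], of z "?B t *v z t"]
        that t by (simp add: solves_linear_ivp_def)
  qed (use that in \<open>simp add: solves_linear_ivp_def\<close>)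
  have from_x: "solves_linear_ivp T ?B t0 (?M t0 *v x0) (\<lambda>t. ?M t *v x t)"
    if "solves_linear_ivp T A t0 x0 x" for t0 x0 x
    unfolding solves_linear_ivp_def
  proof (intro conjI ballI)
    fix t assume t: "t \<in> kappa T"
    have M': "has_delta_derivative T ?M (- (?M (fwd_jump T t) ** delta_deriv T L t ** ?M t)) t"
      by (rule has_delta_derivative_matrix_inv[OF L'[OF t] kappa[OF t] \<open>closed T\<close> inv])
    have neg: "(- N) *v y = - (N *v y)" for N :: "real^'n^'n" and y
      using matrix_vector_mult_diff_rdistrib[of 0 N y] by simp
    \<comment> \<open>The right side is the product rule for \<open>?M t *v x t\<close> once L M x
      is reduced to x.\<close>
    have "?B t *v (?M t *v x t) = ?M (fwd_jump T t) *v (A t *v (L t *v (?M t *v x t)))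
        - ?M (fwd_jump T t) ** delta_deriv T L t ** ?M t *v x t"
      unfolding matrix_vector_mult_diff_rdistrib
      by (simp add: matrix_vector_mul_assoc matrix_mul_assoc)
    also have "L t *v (?M t *v x t) = x t"
      by (simp add: matrix_vector_mul_assoc matrix_mul_matrix_inv inv kappa t)
    finally show "has_delta_derivative T (\<lambda>t. ?M t *v x t) (?B t *v (?M t *v x t)) t"
      using has_delta_derivative_matrix_vector_mult[OF M' _ kappa[OF t], of x "A t *v x t"]
        that t by (simp add: solves_linear_ivp_def neg)
  qed (use that in \<open>simp add: solves_linear_ivp_def\<close>)
  show ?thesis
  proof
    assume "uniformly_stable T A"
    then show "uniformly_stable T ?B"
      \<comment> \<open>The map \<open>P\<close> goes from the system to be shown stable to the one
        known to be stable, hence x = L z here and z = L^-1 x in the converse.\<close>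
      by (rule uniformly_stable_transfer[where P = L and Q = ?M and p = \<rho> and q = q])
        (simp_all add: from_z matrix_inv_matrix_mul inv L M \<open>\<rho> > 0\<close> \<open>q > 0\<close>)
  next
    assume "uniformly_stable T ?B"
    then show "uniformly_stable T A"
      by (rule uniformly_stable_transfer[where P = ?M and Q = L and p = q and q = \<rho>])
        (simp_all add: from_x matrix_mul_matrix_inv inv L M \<open>\<rho> > 0\<close> \<open>q > 0\<close>)
  qed
qed

end
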